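(* $st$-Short Unsecluded Path can be solved in $O((\ell+1)^{k})\cdot n^{O(1)}$ time, where $n$ is the number of vertices of the input graph; hence it is fixed-parameter tractable when parameterized by $k+\ell$.
   Context: All graphs are finite, simple and undirected. For a graph $G=(V,E)$ and $W\subseteq V$, the open neighborhood of $W$ is $N_G(W)=\{v\in V\setminus W : \exists w\in W,\ \{v,w\}\in E\}$. $st$-Short Unsecluded Path: given an undirected graph $G$, two distinct vertices $s,t$ of $G$, and integers $k\ge 2$, $\ell\ge 0$, decide whether there is a simple path $P$ in $G$ with endpoints $s$ and $t$ such that $|V(P)|\le k$ and $|N_G(V(P))|\ge\ell$. A parameterized problem is fixed-parameter tractable with respect to $p$ if every instance $x$ can be decided in $g(p)\cdot|x|^{O(1)}$ time for some computable $g$. *)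

theory Defs
  imports Main "HOL-Library.Log_Nat"
begin

section \<open>Short unsecluded paths\<close>

record 'a graph =
  verts :: "'a set"
  edges :: "'a set set"

definition simple_graph :: "'a graph \<Rightarrow> bool" where
  "simple_graph G \<longleftrightarrow> finite (verts G) \<and> (\<forall>e\<in>edges G. e \<subseteq> verts G \<and> card e = 2)"

definition open_nbhd :: "'a graph \<Rightarrow> 'a set \<Rightarrow> 'a set" where
  "open_nbhd G W = {v \<in> verts G - W. \<exists>w\<in>W. {v, w} \<in> edges G}"

text \<open>A simple path is given by the sequence of its vertices.\<close>

definition simple_path :: "'a graph \<Rightarrow> 'a \<Rightarrow> 'a \<Rightarrow> 'a list \<Rightarrow> bool" where
  "simple_path G s t P \<longleftrightarrow>
     P \<noteq> [] \<and> hd P = s \<and> last P = t \<and> distinct P \<and> set P \<subseteq> verts G \<and>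
     successively (\<lambda>u v. {u, v} \<in> edges G) P"

type_synonym 'a sup_instance = "'a graph \<times> 'a \<times> 'a \<times> nat \<times> nat"

definition short_unsecluded_path :: "'a sup_instance \<Rightarrow> bool" where
  "short_unsecluded_path = (\<lambda>(G, s, t, k, l).
     \<exists>P. simple_path G s t P \<and> card (set P) \<le> k \<and> card (open_nbhd G (set P)) \<ge> l)"

text \<open>As inputs to an algorithm, graphs with \<open>n\<close> vertices have vertex set \<open>{0, \<dots>, n - 1}\<close>.\<close>

definition sup_instances :: "nat sup_instance set" where
  "sup_instances = {(G, s, t, k, l).
     simple_graph G \<and> verts G = {..<card (verts G)} \<and>
     s \<in> verts G \<and> t \<in> verts G \<and> s \<noteq> t \<and> k \<ge> 2}"

text \<open>The graph is presented by its number of vertices and its adjacency matrix, row by row.\<close>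

definition encode_sup :: "nat sup_instance \<Rightarrow> nat list" where
  "encode_sup = (\<lambda>(G, s, t, k, l).
     let n = card (verts G) in
     [n, s, t, k, l] @ [if {i, j} \<in> edges G then 1 else 0. i \<leftarrow> [0..<n], j \<leftarrow> [0..<n]])"


section \<open>Random access machines\<close>

text \<open>
  The machine has registers and a memory that is addressed indirectly through registers; both hold
  natural numbers. The only arithmetic is increment and decrement, so a run of \<open>T\<close> steps
  handles no number exceeding those in the program and the input, and the length of the input, by
  more than \<open>T\<close>, and
  charging one unit of time per instruction cannot hide computations on long numbers.
  Control flow is structured, which compared with jumps affects running times only by a constant
  factor.
\<close>

datatype com =
    Skip
  | Const nat nat
  | Copy nat nat
  | Inc nat
  | Dec nat
  | Load nat nat
  | Store nat nat
  | Seq com com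
  | Cond nat com com
  | While nat com

type_synonym state = "(nat \<Rightarrow> nat) \<times> (nat \<Rightarrow> nat)"

text \<open>\<open>exec c \<sigma> T \<tau>\<close>: started in the state \<open>\<sigma>\<close>, the program \<open>c\<close> halts after
  exactly \<open>T\<close> units of time in the state \<open>\<tau>\<close>. States are pairs of registers and memory.\<close>

inductive exec :: "com \<Rightarrow> state \<Rightarrow> nat \<Rightarrow> state \<Rightarrow> bool" where
  Skip: "exec Skip \<sigma> 1 \<sigma>"
| Const: "exec (Const i a) (R, M) 1 (R(i := a), M)"
| Copy: "exec (Copy i j) (R, M) 1 (R(i := R j), M)"
| Inc: "exec (Inc i) (R, M) 1 (R(i := R i + 1), M)"
| Dec: "exec (Dec i) (R, M) 1 (R(i := R i - 1), M)"
| Load: "exec (Load i j) (R, M) 1 (R(i := M (R j)), M)"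
| Store: "exec (Store i j) (R, M) 1 (R, M(R i := R j))"
| Seq: "exec c \<sigma> T \<sigma>' \<Longrightarrow> exec d \<sigma>' T' \<sigma>'' \<Longrightarrow> exec (Seq c d) \<sigma> (T + T') \<sigma>''"
| CondTrue: "fst \<sigma> i \<noteq> 0 \<Longrightarrow> exec c \<sigma> T \<sigma>' \<Longrightarrow> exec (Cond i c d) \<sigma> (1 + T) \<sigma>'"
| CondFalse: "fst \<sigma> i = 0 \<Longrightarrow> exec d \<sigma> T \<sigma>' \<Longrightarrow> exec (Cond i c d) \<sigma> (1 + T) \<sigma>'"
| WhileTrue: "fst \<sigma> i \<noteq> 0 \<Longrightarrow> exec c \<sigma> T \<sigma>' \<Longrightarrow> exec (While i c) \<sigma>' T' \<sigma>'' \<Longrightarrow>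
    exec (While i c) \<sigma> (1 + T + T') \<sigma>''"
| WhileFalse: "fst \<sigma> i = 0 \<Longrightarrow> exec (While i c) \<sigma> 1 \<sigma>"

lemma exec_deterministic:
  assumes "exec c \<sigma> T \<tau>" and "exec c \<sigma> T' \<tau>'"
  shows "T' = T \<and> \<tau>' = \<tau>"
  using assms
proof (induction arbitrary: T' \<tau>' rule: exec.induct)
  case (Seq c \<sigma> T \<sigma>' d U \<sigma>'')
  note IH = Seq.IH
  from Seq.prems obtain V V' \<rho> where "T' = V + V'" "exec c \<sigma> V \<rho>" "exec d \<rho> V' \<tau>'"
    by cases
  with IH(1)[of V \<rho>] IH(2)[of V' \<tau>'] show ?case
    by simp
next
  case (CondTrue \<sigma> i c T \<sigma>' d)
  from CondTrue.prems CondTrue.hyps obtain V where "T' = 1 + V" "exec c \<sigma> V \<tau>'"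
    by cases simp_all
  with CondTrue.IH[of V \<tau>'] show ?case
    by simp
next
  case (CondFalse \<sigma> i d T \<sigma>' c)
  from CondFalse.prems CondFalse.hyps obtain V where "T' = 1 + V" "exec d \<sigma> V \<tau>'"
    by cases simp_all
  with CondFalse.IH[of V \<tau>'] show ?case
    by simp
next
  case (WhileTrue \<sigma> i c T \<sigma>' U \<sigma>'')
  note IH = WhileTrue.IH
  from WhileTrue.prems WhileTrue.hyps obtain V V' \<rho>
    where "T' = 1 + V + V'" "exec c \<sigma> V \<rho>" "exec (While i c) \<rho> V' \<tau>'"
    by cases simp_all
  with IH(1)[of V \<rho>] IH(2)[of V' \<tau>'] show ?case
    by simp
next
  case (WhileFalse \<sigma> i c)
  from WhileFalse.prems WhileFalse.hyps show ?case
    by cases simp_all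
qed (erule exec.cases; simp)+

text \<open>The input words occupy the memory from address \<open>0\<close> on, and register \<open>0\<close> holds
  their number. Register \<open>0\<close> also holds the result of a computation.\<close>

definition initial_state :: "nat list \<Rightarrow> state" where
  "initial_state xs =
     ((\<lambda>_. 0)(0 := length xs), \<lambda>a. if a < length xs then xs ! a else 0)"

definition decides_within :: "com \<Rightarrow> nat list \<Rightarrow> bool \<Rightarrow> nat \<Rightarrow> bool" where
  "decides_within c xs b B \<longleftrightarrow>
     (\<exists>T \<tau>. exec c (initial_state xs) T \<tau> \<and> T \<le> B \<and> (fst \<tau> 0 \<noteq> 0 \<longleftrightarrow> b))"

definition computable :: "(nat \<Rightarrow> nat) \<Rightarrow> bool" where
  "computable g \<longleftrightarrow> (\<exists>c. \<forall>m. \<exists>T \<tau>. exec c (initial_state [m]) T \<tau> \<and> fst \<tau> 0 = g m)"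


section \<open>Fixed-parameter tractability\<close>

text \<open>The size of an input is its length in binary.\<close>

definition input_size :: "nat list \<Rightarrow> nat" where
  "input_size xs = (\<Sum>x\<leftarrow>xs. max 1 (floorlog 2 x))"

text \<open>A parameterized problem consists of a set \<open>I\<close> of instances, an encoding \<open>enc\<close> of the instances
  as machine inputs, the predicate \<open>yes\<close> to be decided, and the parameter \<open>par\<close>.\<close>

definition fixed_parameter_tractable ::
  "'i set \<Rightarrow> ('i \<Rightarrow> nat list) \<Rightarrow> ('i \<Rightarrow> bool) \<Rightarrow> ('i \<Rightarrow> nat) \<Rightarrow> bool" where
  "fixed_parameter_tractable I enc yes par \<longleftrightarrow>
     (\<exists>c g d. computable g \<and>
        (\<forall>x\<in>I. decides_within c (enc x) (yes x) (g (par x) * input_size (enc x) ^ d)))"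

end

(*
  Depth-first search over the paths p that start in s. Let v be the last vertex of p. If v has more
  than l neighbours outside p, the answer on this branch depends on distances alone: a shortest
  v-t-path avoiding p contains only one neighbour of v, so appending it to p leaves at least l
  neighbours of the resulting path, and it remains to compare its length with k by breadth-first
  search. Otherwise there are at most l ways to extend p. So the search tree has depth less than k,
  branching degree at most l, and every node takes polynomial time.
*)

theory Submission
  imports Defs
begin

section \<open>Reasoning about programs and their running time\<close>

text \<open>The machine has neither addition nor comparison, and \<open>k\<close> and
  \<open>l\<close> may be far larger than \<open>n\<close>, so no loop may run \<open>k\<close> or
  \<open>l\<close> times. Thresholds are therefore tested by decrementing a copy of the threshold
  during an array scan, equality of two vertices by marking one in a bit array and reading the entry
  of the other, and breadth-first search runs \<open>n\<close> rounds whatever the budget. Recursion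
  becomes a single loop over an explicit stack with a cursor. Success ends that loop from any depth,
  so a subtree has no single exit state; its specification speaks about the whole remaining run of
  the loop instead.\<close>

definition wp :: "com \<Rightarrow> state \<Rightarrow> (nat \<Rightarrow> state \<Rightarrow> bool) \<Rightarrow> bool" where
  "wp c \<sigma> Q \<longleftrightarrow> (\<exists>T \<tau>. exec c \<sigma> T \<tau> \<and> Q T \<tau>)"

abbreviation runs :: "com \<Rightarrow> state \<Rightarrow> nat \<Rightarrow> (state \<Rightarrow> bool) \<Rightarrow> bool" where
  "runs c \<sigma> B Q \<equiv> wp c \<sigma> (\<lambda>T \<tau>. T \<le> B \<and> Q \<tau>)"

lemma exec_atom_iff:
  "exec Skip \<sigma> T \<tau> \<longleftrightarrow> T = 1 \<and> \<tau> = \<sigma>"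
  "exec (Const i a) (R, M) T \<tau> \<longleftrightarrow> T = 1 \<and> \<tau> = (R(i := a), M)"
  "exec (Copy i j) (R, M) T \<tau> \<longleftrightarrow> T = 1 \<and> \<tau> = (R(i := R j), M)"
  "exec (Inc i) (R, M) T \<tau> \<longleftrightarrow> T = 1 \<and> \<tau> = (R(i := R i + 1), M)"
  "exec (Dec i) (R, M) T \<tau> \<longleftrightarrow> T = 1 \<and> \<tau> = (R(i := R i - 1), M)"
  "exec (Load i j) (R, M) T \<tau> \<longleftrightarrow> T = 1 \<and> \<tau> = (R(i := M (R j)), M)"
  "exec (Store i j) (R, M) T \<tau> \<longleftrightarrow> T = 1 \<and> \<tau> = (R, M(R i := R j))"
  by (auto elim: exec.cases intro: exec.intros[simplified])

lemma wp_atom [simp]: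
  "wp Skip \<sigma> Q \<longleftrightarrow> Q 1 \<sigma>"
  "wp (Const i a) (R, M) Q \<longleftrightarrow> Q 1 (R(i := a), M)"
  "wp (Copy i j) (R, M) Q \<longleftrightarrow> Q 1 (R(i := R j), M)"
  "wp (Inc i) (R, M) Q \<longleftrightarrow> Q 1 (R(i := R i + 1), M)"
  "wp (Dec i) (R, M) Q \<longleftrightarrow> Q 1 (R(i := R i - 1), M)"
  "wp (Load i j) (R, M) Q \<longleftrightarrow> Q 1 (R(i := M (R j)), M)"
  "wp (Store i j) (R, M) Q \<longleftrightarrow> Q 1 (R, M(R i := R j))"
  unfolding wp_def exec_atom_iff by simp_all

lemma wp_Seq [simp]: "wp (Seq c d) \<sigma> Q \<longleftrightarrow> wp c \<sigma> (\<lambda>T \<tau>. wp d \<tau> (\<lambda>T'. Q (T + T')))"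
  unfolding wp_def by (blast elim: exec.cases[of "Seq c d"] intro: exec.Seq)

lemma exec_Cond_iff:
  "exec (Cond i c d) \<sigma> T \<tau> \<longleftrightarrow> (\<exists>T'. T = 1 + T' \<and> exec (if fst \<sigma> i \<noteq> 0 then c else d) \<sigma> T' \<tau>)"
  by (auto elim: exec.cases[of "Cond i c d"] intro: exec.CondTrue[simplified] exec.CondFalse[simplified])

lemma wp_Cond [simp]:
  "wp (Cond i c d) \<sigma> Q \<longleftrightarrow> (if fst \<sigma> i \<noteq> 0 then wp c \<sigma> (\<lambda>T. Q (1 + T)) else wp d \<sigma> (\<lambda>T. Q (1 + T)))"
  unfolding wp_def exec_Cond_iff by auto

lemma wp_mono: "wp c \<sigma> P \<Longrightarrow> (\<And>T \<tau>. P T \<tau> \<Longrightarrow> Q T \<tau>) \<Longrightarrow> wp c \<sigma> Q"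
  unfolding wp_def by blast

lemma wp_While:
  assumes "fst \<sigma> i \<noteq> 0" and "wp c \<sigma> (\<lambda>T \<tau>. wp (While i c) \<tau> (\<lambda>T'. Q (1 + T + T')))"
  shows "wp (While i c) \<sigma> Q"
  using assms unfolding wp_def by (blast intro: exec.WhileTrue)

lemma wp_While_end: "fst \<sigma> i = 0 \<Longrightarrow> Q 1 \<sigma> \<Longrightarrow> wp (While i c) \<sigma> Q"
  unfolding wp_def by (blast intro: exec.WhileFalse)

lemma runs_While:
  assumes "fst \<sigma> i \<noteq> 0" and "runs c \<sigma> b (\<lambda>\<tau>. runs (While i c) \<tau> B Q)"
  shows "runs (While i c) \<sigma> (1 + b + B) Q"
  by (rule wp_While[OF assms(1)], rule wp_mono[OF assms(2)]) (auto elim!: wp_mono)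

text \<open>\<open>I m t\<close> couples the number \<open>m\<close> of finished rounds with the
  exact time \<open>t\<close> spent on them, tests included. The \<open>t + 1\<close> in the
  conclusion pays for the final failing test.\<close>

lemma wp_loop:
  assumes "I 0 0 \<sigma>"
    and step: "\<And>m t \<sigma>. m < N \<Longrightarrow> I m t \<sigma> \<Longrightarrow>
      fst \<sigma> i \<noteq> 0 \<and> wp c \<sigma> (\<lambda>T. I (Suc m) (t + T + 1))"
    and stop: "\<And>t \<sigma>. I N t \<sigma> \<Longrightarrow> fst \<sigma> i = 0"
  shows "wp (While i c) \<sigma> (\<lambda>T \<tau>. \<exists>t. T = t + 1 \<and> I N t \<tau>)"
proof -
  have "wp (While i c) \<sigma> (\<lambda>T \<tau>. \<exists>t'. t + T = t' + 1 \<and> I N t' \<tau>)" if "I m t \<sigma>" "m + j = N" for m j t \<sigma>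
    using that
  proof (induction j arbitrary: m t \<sigma>)
    case 0
    with stop[of t \<sigma>] show ?case
      by (auto intro!: wp_While_end)
  next
    case (Suc j)
    have *: "fst \<sigma> i \<noteq> 0" "wp c \<sigma> (\<lambda>T. I (Suc m) (t + T + 1))"
      using step[of m t \<sigma>] Suc.prems by auto
    show ?case
    proof (rule wp_While[OF *(1)], rule wp_mono[OF *(2)])
      fix T \<tau>
      assume "I (Suc m) (t + T + 1) \<tau>"
      from Suc.IH[OF this] Suc.prems
      show "wp (While i c) \<tau> (\<lambda>T' \<tau>. \<exists>t'. t + (1 + T + T') = t' + 1 \<and> I N t' \<tau>)"
        by (simp add: add_ac)
    qed
  qed
  from this[of 0 0 \<sigma> N] assms(1) show ?thesis
    by simp
qed

lemma runs_loop:
  assumes "I 0 \<sigma>"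
    and step: "\<And>m \<sigma>. m < N \<Longrightarrow> I m \<sigma> \<Longrightarrow> fst \<sigma> i \<noteq> 0 \<and> runs c \<sigma> b (I (Suc m))"
    and "\<And>\<sigma>. I N \<sigma> \<Longrightarrow> fst \<sigma> i = 0"
  shows "runs (While i c) \<sigma> (N * (b + 1) + 1) (I N)"
proof -
  have "wp (While i c) \<sigma> (\<lambda>T \<tau>. \<exists>t. T = t + 1 \<and> t \<le> N * (b + 1) \<and> I N \<tau>)"
  proof (rule wp_loop[where I = "\<lambda>m t \<tau>. t \<le> m * (b + 1) \<and> I m \<tau>"])
    fix m t \<sigma>
    assume "m < N" "t \<le> m * (b + 1) \<and> I m \<sigma>"
    with step[of m \<sigma>]
    show "fst \<sigma> i \<noteq> 0 \<and> wp c \<sigma> (\<lambda>T \<tau>. t + T + 1 \<le> Suc m * (b + 1) \<and> I (Suc m) \<tau>)"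
      by (auto elim!: wp_mono)
  qed (use assms in auto)
  then show ?thesis
    by (auto elim!: wp_mono)
qed

notation Seq (infixr ";;" 60)

section \<open>The search program\<close>

definition sum_addr :: "nat \<Rightarrow> nat \<Rightarrow> com" where
  "sum_addr i j = Copy 14 i;; Copy 15 j;; While 15 (Inc 14;; Dec 15)"

lemma runs_sum_addr:
  assumes "R j \<le> n" and "j \<noteq> 14"
  shows "runs (sum_addr i j) (R, M) (3 * n + 3) (\<lambda>\<sigma>. \<sigma> = (R(14 := R i + R j, 15 := 0), M))"
proof -
  let ?I = "\<lambda>m \<sigma>. \<sigma> = (R(14 := R i + m, 15 := R j - m), M)"
  have "runs (While 15 (Inc 14;; Dec 15)) (R(14 := R i, 15 := R j), M) (R j * (2 + 1) + 1) (?I (R j))"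
    by (rule runs_loop[where I = ?I]) (auto simp: fun_eq_iff)
  then show ?thesis
    using assms unfolding sum_addr_def by (auto elim!: wp_mono simp: fun_eq_iff)
qed

text \<open>Memory holds the input, then arrays \<open>U\<close>, \<open>A\<close> and \<open>B\<close> of \<open>n\<close> truth values, which represent
  sets of vertices, and then the stack of the vertices of the current path. \<open>U\<close> is the set of these
  vertices. Registers 0, 5 and 6 hold the addresses of \<open>U\<close>, \<open>A\<close>, \<open>B\<close>, and register 7 the first free
  address of the stack. Registers 1, 2 and 4 hold \<open>n\<close>, \<open>t\<close> and \<open>l\<close>, register 3 what is left of the
  budget \<open>k\<close>, and register 10 the length of the path. Register 8 is the last vertex of the path and
  register 9 the cursor: the vertices below it are still to be tried as the next vertex. Register 11
  is the answer. Registers from 12 on are scratch.\<close>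

definition scan :: "com \<Rightarrow> com" where
  "scan c = Copy 14 0;; Copy 15 5;; Copy 16 6;; Copy 17 1;;
     While 17 (c;; Inc 14;; Inc 15;; Inc 16;; Dec 17)"

text \<open>Registers 14, 15 and 16 sweep \<open>U\<close>, \<open>A\<close> and \<open>B\<close> in
  parallel and register 17 counts down, so the body must preserve everything below 18. Register 18
  is the accumulator of the scan; \<open>J\<close> tracks it together with the memory.\<close>

lemma runs_scan:
  assumes J: "J 0 (R 18) M"
    and step: "\<And>u R' M'. u < R 1 \<Longrightarrow> \<forall>i<14. R' i = R i \<Longrightarrow> R' 14 = R 0 + u \<Longrightarrow> R' 15 = R 5 + u \<Longrightarrow>
      R' 16 = R 6 + u \<Longrightarrow> J u (R' 18) M' \<Longrightarrow>
      runs c (R', M') b (\<lambda>(R'', M''). (\<forall>i<18. R'' i = R' i) \<and> J (Suc u) (R'' 18) M'')"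
  shows "runs (scan c) (R, M) (R 1 * (b + 5) + 5) (\<lambda>(R', M'). (\<forall>i<14. R' i = R i) \<and> J (R 1) (R' 18) M')"
proof -
  let ?I = "\<lambda>u (R', M'). (\<forall>i<14. R' i = R i) \<and> R' 14 = R 0 + u \<and> R' 15 = R 5 + u \<and>
      R' 16 = R 6 + u \<and> R' 17 = R 1 - u \<and> J u (R' 18) M'"
  have "runs (While 17 (c;; Inc 14;; Inc 15;; Inc 16;; Dec 17))
      (R(14 := R 0, 15 := R 5, 16 := R 6, 17 := R 1), M) (R 1 * ((b + 4) + 1) + 1) (?I (R 1))"
  proof (rule runs_loop[where I = ?I], goal_cases)
    case 1
    show ?case using J by simp
  next
    case (2 u \<sigma>)
    obtain R' M' where \<sigma>: "\<sigma> = (R', M')" by fastforce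
    with 2 have "runs c (R', M') b (\<lambda>(R'', M''). (\<forall>i<18. R'' i = R' i) \<and> J (Suc u) (R'' 18) M'')"
      by (intro step) auto
    then show ?case
      using 2 unfolding \<sigma> by (auto elim!: wp_mono)
  next
    case (3 \<sigma>)
    then show ?case by auto
  qed
  then show ?thesis
    unfolding scan_def by (auto elim!: wp_mono simp: add_ac)
qed

definition clear_A :: com where
  "clear_A = scan (Const 19 0;; Store 15 19)"

definition copy_U_to_A :: com where
  "copy_U_to_A = scan (Load 19 14;; Store 15 19)"

definition add_B_to_A :: com where
  "add_B_to_A = scan (Load 19 16;; Cond 19 (Store 15 19) Skip)"

definition count_B :: com where
  "count_B = scan (Load 19 16;; Cond 19 (Dec 18) Skip)"

text \<open>Register 18 is a pointer into the adjacency matrix, which starts behind the five leading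
  input words. It is never reset: the two loops visit the matrix in the order in which it is stored,
  so no row address has to be obtained by multiplication.\<close>

definition neighbours :: com where
  "neighbours = Const 18 5;; scan (Const 19 0;; Copy 20 5;; Copy 21 1;;
     While 21 (Load 22 18;; Cond 22 (Load 22 20;; Cond 22 (Const 19 1) Skip) Skip;;
       Inc 18;; Inc 20;; Dec 21);;
     Load 22 14;; Cond 22 (Const 19 0) Skip;; Store 16 19)"

lemma concat_map_upt_nth:
  assumes "i < m" "j < n"
  shows "concat (map (\<lambda>i. map (f i) [0..<n]) [0..<m]) ! (i * n + j) = f i j"
  using assms(1)
proof (induction m)
  case (Suc m)
  have len: "length (concat (map (\<lambda>i. map (f i) [0..<n]) [0..<m])) = m * n"
    by (induction m) auto
  have "i * n + j < m * n" if "i < m"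
  proof -
    have "i * n + j < Suc i * n" using assms(2) by simp
    also have "\<dots> \<le> m * n" using that by (intro mult_right_mono) auto
    finally show ?thesis .
  qed
  with Suc assms(2) len show ?case
    by (cases "i = m") (auto simp: nth_append)
qed simp

definition singleton_A :: com where
  "singleton_A = clear_A;; sum_addr 5 8;; Const 15 1;; Store 14 15"

text \<open>The loop is controlled by \<open>n\<close> and not by the budget, which may exceed
  \<open>n\<close>, whereas distances stay below \<open>n\<close>. Register 12 suppresses the rounds
  beyond the budget.\<close>

definition search :: com where
  "search = Copy 12 3;; Copy 13 1;;
     While 13 (Cond 12 (neighbours;; add_B_to_A;; Dec 12) Skip;; Dec 13)"

text \<open>Zeroing the path length makes the main loop stop.\<close>

definition accept :: com where
  "accept = Const 11 1;; Const 10 0"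

definition push :: com where
  "push = Store 7 8;; Inc 7;; Dec 3;; Inc 10;; sum_addr 0 8;; Const 15 1;; Store 14 15"

definition target_in_A :: com where
  "target_in_A = sum_addr 5 2;; Load 14 14"

text \<open>Leaves the truncated difference of \<open>l + 1\<close> and the size of \<open>B\<close> in register 18: it is zero iff
  the size exceeds \<open>l\<close>.\<close>

definition count_neighbours :: com where
  "count_neighbours = neighbours;; Copy 18 4;; Inc 18;; count_B"

text \<open>Once \<open>A\<close> is the singleton of the new vertex, reading the entry of
  \<open>t\<close> decides whether this vertex is \<open>t\<close>. For a path ending in
  \<open>t\<close>, the extra \<open>Dec 18\<close> turns the test for more than \<open>l\<close>
  neighbours into one for at least \<open>l\<close>. A cursor of 0 marks a node without
  children.\<close>

definition enter :: com where
  "enter = push;; singleton_A;; target_in_A;;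
     Cond 14
       (copy_U_to_A;; count_neighbours;; Dec 18;; Cond 18 (Const 9 0) accept)
       (count_neighbours;;
        Cond 18
          (Cond 3 (Copy 9 1) (Const 9 0))
          (search;; target_in_A;; Cond 14 accept (Const 9 0)))"

text \<open>The neighbourhood is recomputed for every candidate, because a visit to a subtree
  overwrites \<open>A\<close> and \<open>B\<close>.\<close>

definition next_candidate :: com where
  "next_candidate = Dec 9;; singleton_A;; neighbours;; sum_addr 6 9;; Load 14 14"

definition advance :: com where
  "advance = next_candidate;; Cond 14 (Copy 8 9;; enter) Skip"

text \<open>The removed vertex becomes the cursor, so that the scan of its siblings resumes below it.\<close>

definition retreat :: com where
  "retreat = sum_addr 0 8;; Const 15 0;; Store 14 15;; Inc 3;; Dec 10;; Dec 7;; Copy 9 8;;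
     Copy 14 7;; Dec 14;; Load 8 14"

definition init :: com where
  "init = Load 1 14;; Inc 14;; Load 8 14;; Inc 14;; Load 2 14;; Inc 14;; Load 3 14;; Inc 14;; Load 4 14;;
     sum_addr 0 1;; Copy 5 14;; sum_addr 5 1;; Copy 6 14;; sum_addr 6 1;; Copy 7 14"

definition main_loop :: com where
  "main_loop = While 10 (Cond 9 advance retreat)"

definition decide :: com where
  "decide = init;; enter;; main_loop;; Copy 0 11"

section \<open>Memory contents and the array routines\<close>

locale sup_search =
  fixes G :: "nat graph" and s t k l :: nat
  assumes inst: "(G, s, t, k, l) \<in> sup_instances"
begin

definition n where "n = card (verts G)"
definition N where "N = 5 + n * n"

lemma graph: "verts G = {..<n}" "s < n" "t < n" "s \<noteq> t" "2 \<le> k"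
  using inst unfolding sup_instances_def n_def by auto

text \<open>One operation in three roles: the candidates for extending a path (\<open>U\<close> the
  path, \<open>A\<close> its last vertex), a round of breadth-first search avoiding
  \<open>U\<close>, and, for \<open>U = A\<close>, the open neighbourhood.\<close>

definition nb :: "nat set \<Rightarrow> nat set \<Rightarrow> nat set" where
  "nb U A = {u. u < n \<and> u \<notin> U \<and> (\<exists>i<n. i \<in> A \<and> {u, i} \<in> edges G)}"

abbreviation input where "input \<equiv> encode_sup (G, s, t, k, l)"

lemma length_input: "length input = N"
proof -
  have "length (concat (map (\<lambda>i. map (f i) [0..<n]) [0..<m])) = m * n" for f :: "nat \<Rightarrow> nat \<Rightarrow> nat" and m
    by (induction m) auto
  then show ?thesis
    by (simp add: encode_sup_def N_def n_def Let_def)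
qed

lemma input_nth:
  "input ! 0 = n" "input ! 1 = s" "input ! 2 = t" "input ! 3 = k" "input ! 4 = l"
  "u < n \<Longrightarrow> i < n \<Longrightarrow> input ! (5 + (u * n + i)) = of_bool ({u, i} \<in> edges G)"
  using concat_map_upt_nth[of u n i n "\<lambda>i j. if {i, j} \<in> edges G then 1 else 0 :: nat"]
  by (simp_all add: encode_sup_def n_def Let_def numeral_eq_Suc)

definition mem :: "nat set \<Rightarrow> nat set \<Rightarrow> nat set \<Rightarrow> (nat \<Rightarrow> nat) \<Rightarrow> nat \<Rightarrow> nat" where
  "mem U A B S a =
     (if a < N then input ! a
      else if a < N + n then of_bool (a - N \<in> U)
      else if a < N + 2 * n then of_bool (a - (N + n) \<in> A)
      else if a < N + 3 * n then of_bool (a - (N + 2 * n) \<in> B)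
      else S (a - (N + 3 * n)))"

lemma mem_nth [simp]:
  "a < N \<Longrightarrow> mem U A B S a = input ! a"
  "u < n \<Longrightarrow> mem U A B S (N + u) = of_bool (u \<in> U)"
  "u < n \<Longrightarrow> mem U A B S (N + n + u) = of_bool (u \<in> A)"
  "u < n \<Longrightarrow> mem U A B S (N + 2 * n + u) = of_bool (u \<in> B)"
  "mem U A B S (N + 3 * n + i) = S i"
  by (auto simp: mem_def)

lemma mem_adjacency:
  assumes "u < n" "i < n"
  shows "mem U A B S (5 + u * n + i) = of_bool ({u, i} \<in> edges G)"
proof -
  have "u * n + i < Suc u * n" using assms by simp
  also have "\<dots> \<le> n * n" using assms by (intro mult_right_mono) auto
  finally show ?thesis
    using assms input_nth(6) by (simp add: N_def add.assoc)
qed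

text \<open>Only membership below \<open>n\<close> is stored. Loop invariants may thus describe a
  half-processed array by any convenient set, and the final set is adjusted from \<open>n\<close>
  on.\<close>

lemma mem_cong:
  assumes "\<And>u. u < n \<Longrightarrow> u \<in> U \<longleftrightarrow> u \<in> U'" "\<And>u. u < n \<Longrightarrow> u \<in> A \<longleftrightarrow> u \<in> A'"
    "\<And>u. u < n \<Longrightarrow> u \<in> B \<longleftrightarrow> u \<in> B'"
  shows "mem U A B S = mem U' A' B' S"
  using assms by (auto simp: mem_def fun_eq_iff)

lemma mem_upd:
  "u < n \<Longrightarrow> (mem U A B S)(N + u := of_bool b) = mem (if b then insert u U else U - {u}) A B S"
  "u < n \<Longrightarrow> (mem U A B S)(N + n + u := of_bool b) = mem U (if b then insert u A else A - {u}) B S"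
  "u < n \<Longrightarrow> (mem U A B S)(N + 2 * n + u := of_bool b) = mem U A (if b then insert u B else B - {u}) S"
  "(mem U A B S)(N + 3 * n + i := x) = mem U A B (S(i := x))"
  by (auto simp: mem_def fun_eq_iff)

lemmas mem_upd_bool =
  mem_upd(1)[where b = True, simplified] mem_upd(1)[where b = False, simplified]
  mem_upd(2)[where b = True, simplified] mem_upd(2)[where b = False, simplified]
  mem_upd(3)[where b = True, simplified] mem_upd(3)[where b = False, simplified]

definition cfg :: "(nat \<Rightarrow> nat) \<Rightarrow> bool" where
  "cfg R \<longleftrightarrow> R 0 = N \<and> R 1 = n \<and> R 5 = N + n \<and> R 6 = N + 2 * n"

lemma runs_clear_A:
  assumes "cfg R"
  shows "runs clear_A (R, mem U A B S) (n * 7 + 5) (\<lambda>(R', M'). (\<forall>i<14. R' i = R i) \<and> M' = mem U {} B S)"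
proof -
  have "runs clear_A (R, mem U A B S) (R 1 * (2 + 5) + 5)
      (\<lambda>(R', M'). (\<forall>i<14. R' i = R i) \<and> M' = mem U {u \<in> A. R 1 \<le> u} B S)"
    unfolding clear_A_def
    by (rule runs_scan) (use assms in \<open>auto simp: cfg_def mem_upd_bool intro!: mem_cong\<close>)
  also have "mem U {u \<in> A. R 1 \<le> u} B S = mem U {} B S"
    using assms by (intro mem_cong) (auto simp: cfg_def)
  finally show ?thesis
    using assms by (simp add: cfg_def)
qed

lemma runs_copy_U_to_A:
  assumes "cfg R"
  shows "runs copy_U_to_A (R, mem U A B S) (n * 7 + 5) (\<lambda>(R', M'). (\<forall>i<14. R' i = R i) \<and> M' = mem U U B S)"
proof -
  have "runs copy_U_to_A (R, mem U A B S) (R 1 * (2 + 5) + 5)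
      (\<lambda>(R', M'). (\<forall>i<14. R' i = R i) \<and> M' = mem U {u. if u < R 1 then u \<in> U else u \<in> A} B S)"
    unfolding copy_U_to_A_def
    by (rule runs_scan) (use assms in \<open>auto simp: cfg_def mem_upd less_Suc_eq intro!: mem_cong split: if_splits\<close>)
  also have "mem U {u. if u < R 1 then u \<in> U else u \<in> A} B S = mem U U B S"
    using assms by (intro mem_cong) (auto simp: cfg_def)
  finally show ?thesis
    using assms by (simp add: cfg_def)
qed

lemma runs_add_B_to_A:
  assumes "cfg R"
  shows "runs add_B_to_A (R, mem U A B S) (n * 8 + 5) (\<lambda>(R', M'). (\<forall>i<14. R' i = R i) \<and> M' = mem U (A \<union> B) B S)"
proof -
  have "runs add_B_to_A (R, mem U A B S) (R 1 * (3 + 5) + 5)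
      (\<lambda>(R', M'). (\<forall>i<14. R' i = R i) \<and> M' = mem U (A \<union> {u \<in> B. u < R 1}) B S)"
    unfolding add_B_to_A_def
    by (rule runs_scan) (use assms in \<open>auto simp: cfg_def mem_upd_bool less_Suc_eq intro!: mem_cong\<close>)
  also have "mem U (A \<union> {u \<in> B. u < R 1}) B S = mem U (A \<union> B) B S"
    using assms by (intro mem_cong) (auto simp: cfg_def)
  finally show ?thesis
    using assms by (simp add: cfg_def)
qed

lemma runs_count_B:
  assumes "cfg R" "B \<subseteq> {..<n}"
  shows "runs count_B (R, mem U A B S) (n * 8 + 5)
    (\<lambda>(R', M'). (\<forall>i<14. R' i = R i) \<and> R' 18 = R 18 - card B \<and> M' = mem U A B S)"
proof -
  have *: "{u \<in> B. u < Suc m} = (if m \<in> B then insert m {u \<in> B. u < m} else {u \<in> B. u < m})" for m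
    by (auto simp: less_Suc_eq)
  have "runs count_B (R, mem U A B S) (R 1 * (3 + 5) + 5)
      (\<lambda>(R', M'). (\<forall>i<14. R' i = R i) \<and> R' 18 = R 18 - card {u \<in> B. u < R 1} \<and> M' = mem U A B S)"
    unfolding count_B_def
    by (rule runs_scan) (use assms in \<open>auto simp: cfg_def *\<close>)
  moreover have "{u \<in> B. u < R 1} = B"
    using assms by (auto simp: cfg_def)
  ultimately show ?thesis
    using assms by (simp add: cfg_def)
qed

lemma runs_neighbours:
  assumes "cfg R"
  shows "runs neighbours (R, mem U A B S) (n * (n * 9 + 14) + 6)
    (\<lambda>(R', M'). (\<forall>i<14. R' i = R i) \<and> M' = mem U A (nb U A) S)"
proof -
  \<comment> \<open>The array after \<open>m\<close> entries have been computed: new values below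
    \<open>m\<close>, old ones from \<open>m\<close> on.\<close>
  define B' where "B' = (\<lambda>m. {u. if u < m then u \<in> nb U A else u \<in> B})"
  define adj where "adj = (\<lambda>u m. \<exists>i<m. i \<in> A \<and> {u, i} \<in> edges G)"
  let ?J = "\<lambda>u x M. x = 5 + u * n \<and> M = mem U A (B' u) S"
  let ?in = "While 21 (Load 22 18;; Cond 22 (Load 22 20;; Cond 22 (Const 19 1) Skip) Skip;;
       Inc 18;; Inc 20;; Dec 21)"
  have R: "R 1 = n" "R 0 = N" "R 5 = N + n" "R 6 = N + 2 * n"
    using assms by (auto simp: cfg_def)
  have *: "runs ?in (R'(19 := 0, 20 := R' 5, 21 := R' 1), mem U A (B' u) S) (n * (8 + 1) + 1)
      (\<lambda>(R'', M'). (\<forall>i<18. R'' i = R' i) \<and> R'' 18 = 5 + Suc u * n \<and>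
        R'' 19 = of_bool (adj u n) \<and> M' = mem U A (B' u) S)"
    if "u < n" "R' 5 = N + n" "R' 1 = n" "R' 18 = 5 + u * n" for R' u
  proof -
    define M' where "M' = mem U A (B' u) S"
    have adj: "\<not> adj u 0" "adj u (Suc m) \<longleftrightarrow> adj u m \<or> m \<in> A \<and> {u, m} \<in> edges G" for m
      unfolding adj_def by (auto simp: less_Suc_eq)
    have M': "M' (5 + u * n + m) = of_bool ({u, m} \<in> edges G)" "M' (N + n + m) = of_bool (m \<in> A)"
      if "m < n" for m
      using that \<open>u < n\<close> by (simp_all add: M'_def mem_adjacency)
    let ?I = "\<lambda>m (R'', M''). (\<forall>i<18. R'' i = R' i) \<and> R'' 18 = 5 + u * n + m \<and>
      R'' 19 = of_bool (adj u m) \<and> R'' 20 = N + n + m \<and> R'' 21 = n - m \<and> M'' = M'"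
    have "runs ?in (R'(19 := 0, 20 := R' 5, 21 := R' 1), M') (n * (8 + 1) + 1) (?I n)"
      by (rule runs_loop[where I = ?I])
        (use that in \<open>auto simp: adj M'\<close>)
    then show ?thesis
      unfolding M'_def by (rule wp_mono) auto
  qed
  have "runs neighbours (R, mem U A B S) (R 1 * ((n * 9 + 9) + 5) + 6)
      (\<lambda>(R', M'). (\<forall>i<14. R' i = R i) \<and> ?J (R 1) (R' 18) M')"
  proof -
    have "runs (scan (Const 19 0;; Copy 20 5;; Copy 21 1;; ?in;;
        Load 22 14;; Cond 22 (Const 19 0) Skip;; Store 16 19)) (R(18 := 5), mem U A B S)
        ((R(18 := 5)) 1 * ((n * 9 + 9) + 5) + 5)
        (\<lambda>(R', M'). (\<forall>i<14. R' i = (R(18 := 5)) i) \<and> ?J ((R(18 := 5)) 1) (R' 18) M')"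
    proof (rule runs_scan[where J = ?J], goal_cases)
      case 1
      show ?case by (simp add: B'_def)
    next
      case (2 u R' M')
      have u: "u < n" "R' 5 = N + n" "R' 1 = n" "R' 18 = 5 + u * n"
        using 2 R by auto
      have B: "(mem U A (B' u) S)(N + 2 * n + u := of_bool (u \<notin> U \<and> adj u n)) = mem U A (B' (Suc u)) S"
        unfolding mem_upd(3)[OF \<open>u < n\<close>] using \<open>u < n\<close>
        by (intro mem_cong) (auto simp: less_Suc_eq nb_def B'_def adj_def)
      have M': "M' = mem U A (B' u) S"
        using 2 by simp
      show ?case
        by (simp, rule wp_mono[OF *[OF u, folded M', simplified]]) (use 2 R u B[folded M'] in \<open>auto simp: add.assoc split: if_splits\<close>)
    qed
    then show ?thesis
      unfolding neighbours_def by (auto elim!: wp_mono)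
  qed
  moreover have "mem U A (B' (R 1)) S = mem U A (nb U A) S"
    using assms by (intro mem_cong) (auto simp: cfg_def B'_def)
  ultimately show ?thesis
    using assms by (auto simp add: cfg_def add_ac elim!: wp_mono)
qed

section \<open>Breadth-first search\<close>

definition ball :: "nat set \<Rightarrow> nat \<Rightarrow> nat \<Rightarrow> nat set" where
  "ball U v r = ((\<lambda>A. A \<union> nb U A) ^^ r) {v}"

lemma ball_simps [simp]:
  "ball U v 0 = {v}" "ball U v (Suc r) = ball U v r \<union> nb U (ball U v r)"
  by (simp_all add: ball_def)

lemma runs_singleton_A:
  assumes "cfg R" "R 8 < n"
  shows "runs singleton_A (R, mem U A B S) (n * 10 + 10)
    (\<lambda>(R', M'). (\<forall>i<14. R' i = R i) \<and> M' = mem U {R 8} B S)"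
  unfolding singleton_A_def
  apply simp
  apply (rule wp_mono[OF runs_clear_A[OF assms(1)]])
  apply clarsimp
  apply (rule wp_mono[OF runs_sum_addr[where n = n]])
  using assms by (auto simp: cfg_def mem_upd_bool)

lemma runs_search:
  assumes "cfg R"
  shows "runs search (R, mem U {v} B S) (n * (n * (n * 9) + n * 22 + 15) + 3)
    (\<lambda>(R', M'). (\<forall>i<12. R' i = R i) \<and> (\<exists>B'. M' = mem U (ball U v (min n (R 3))) B' S))"
proof -
  let ?body = "Cond 12 (neighbours;; add_B_to_A;; Dec 12) Skip;; Dec 13"
  let ?I = "\<lambda>m (R', M'). (\<forall>i<12. R' i = R i) \<and> R' 12 = R 3 - m \<and> R' 13 = n - m \<and>
    (\<exists>B'. M' = mem U (ball U v (min m (R 3))) B' S)"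
  have R: "R 1 = n" using assms by (simp add: cfg_def)
  have "runs (While 13 ?body) (R(12 := R 3, 13 := R 1), mem U {v} B S)
      (n * ((n * (n * 9) + n * 22 + 14) + 1) + 1) (?I n)"
  proof (rule runs_loop[where I = ?I], goal_cases)
    case 1
    show ?case using R by auto
  next
    case (2 m \<sigma>)
    obtain R' M' where \<sigma>: "\<sigma> = (R', M')" by fastforce
    with 2 obtain B' where R': "\<forall>i<12. R' i = R i" "R' 12 = R 3 - m" "R' 13 = n - m"
      and M': "M' = mem U (ball U v (min m (R 3))) B' S"
      by auto
    have cfg: "cfg R'" using assms R' by (simp add: cfg_def)
    show ?case
    proof (cases "m < R 3")
      case True
      then have pos: "R' 12 \<noteq> 0" "R' 13 \<noteq> 0"
        using R' \<open>m < n\<close> by auto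
      show ?thesis
        unfolding \<sigma> M'
        apply (simp only: wp_Seq wp_Cond fst_conv pos simp_thms if_True not_False_eq_True)
        apply (rule wp_mono[OF runs_neighbours[OF cfg]])
        apply clarsimp
        apply (rule wp_mono[OF runs_add_B_to_A])
        using cfg True R' by (auto simp: cfg_def min_def algebra_simps)
    next
      case False
      then show ?thesis
        unfolding \<sigma> using R' M' \<open>m < n\<close> by (auto simp: min_def)
    qed
  next
    case (3 \<sigma>)
    then show ?case by auto
  qed
  then show ?thesis
    unfolding search_def by (auto elim!: wp_mono simp: add_ac)
qed

text \<open>\<open>v\<close> is kept apart from \<open>last p\<close>: register 8 also holds a
  vertex that is about to be pushed, and after the last pop its value is arbitrary.
  \<open>A\<close>, \<open>B\<close> and the stack cells above the path are scratch.\<close>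

definition rep :: "nat list \<Rightarrow> nat \<Rightarrow> nat \<Rightarrow> state \<Rightarrow> bool" where
  "rep p v c = (\<lambda>(R, M). cfg R \<and> R 2 = t \<and> R 3 = k - length p \<and> R 4 = l \<and>
     R 7 = N + 3 * n + length p \<and> R 8 = v \<and> R 9 = c \<and> R 10 = length p \<and> R 11 = 0 \<and>
     (\<exists>A B S. M = mem (set p) A B S \<and> (\<forall>i<length p. S i = p ! i)))"

definition found :: "state \<Rightarrow> bool" where
  "found \<sigma> \<longleftrightarrow> fst \<sigma> 10 = 0 \<and> fst \<sigma> 11 = 1"

definition good :: "nat list \<Rightarrow> bool" where
  "good p \<longleftrightarrow>
     (if last p = t then l \<le> card (nb (set p) (set p))
      else l < card (nb (set p) {last p}) \<and> t \<in> ball (set p) (last p) (min n (k - length p)))"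

definition expand :: "nat list \<Rightarrow> bool" where
  "expand p \<longleftrightarrow> last p \<noteq> t \<and> card (nb (set p) {last p}) \<le> l \<and> length p < k"

section \<open>Single moves: extending and shortening the path\<close>

lemma nb_subset: "nb U A \<subseteq> {..<n}"
  by (auto simp: nb_def)

lemma finite_nb [simp]: "finite (nb U A)"
  by (rule finite_subset[OF nb_subset]) simp

lemma runs_enter:
  assumes rep: "rep p v c (R, M)" and v: "v < n"
  shows "runs enter (R, M) (n * (n * (n * 9) + n * 22 + 15) + n * (n * 9) + n * 50 + 70)
    (\<lambda>\<tau>. if good (p @ [v]) then found \<tau>
         else rep (p @ [v]) v (if expand (p @ [v]) then n else 0) \<tau>)"
proof -
  let ?p = "p @ [v]"
  from rep obtain A B S where cfg: "cfg R" and R: "R 2 = t" "R 3 = k - length p" "R 4 = l"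
      "R 7 = N + 3 * n + length p" "R 8 = v" "R 9 = c" "R 10 = length p" "R 11 = 0"
    and M: "M = mem (set p) A B S" and S: "\<forall>i<length p. S i = p ! i"
    unfolding rep_def by auto
  define S' where "S' = S(length p := v)"
  have S': "\<forall>i<length ?p. S' i = ?p ! i"
    using S unfolding S'_def by (auto simp: nth_append less_Suc_eq)
  define R1 where "R1 = R(7 := N + 3 * n + length ?p, 3 := k - length ?p, 10 := length ?p)"
  have cfg1: "cfg R1" using cfg by (simp add: R1_def cfg_def)
  have R1: "R1 2 = t" "R1 3 = k - length ?p" "R1 4 = l" "R1 7 = N + 3 * n + length ?p" "R1 8 = v"
      "R1 10 = length ?p" "R1 11 = 0"
    using R by (auto simp: R1_def)
  \<comment> \<open>The interface between the stages of \<open>enter\<close>: registers below 12 as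
    left by the push, \<open>A\<close> known, \<open>B\<close> arbitrary. Every stage after the push
    leads from one such state to another, until the cursor or the answer is set.\<close>
  define st where "st A \<sigma> \<longleftrightarrow> (\<forall>i<12. fst \<sigma> i = R1 i) \<and> (\<exists>B. snd \<sigma> = mem (set ?p) A B S')" for A \<sigma>
  have cfgI: "cfg R'" if "\<forall>i<12. R' i = R1 i" for R'
    using cfg1 that by (auto simp: cfg_def)
  have repI: "rep ?p v x (R'(9 := x), M')" if "st A (R', M')" for R' M' x A
    using that cfg1 R1 S' unfolding rep_def cfg_def st_def by auto
  have accept: "wp accept \<sigma> Q \<longleftrightarrow> Q 2 ((fst \<sigma>)(11 := 1, 10 := 0), snd \<sigma>)" for \<sigma> Q
    unfolding accept_def by (cases \<sigma>) (simp add: numeral_2_eq_2)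
  have target: "runs target_in_A \<sigma> (3 * n + 4) (\<lambda>\<tau>. st A \<tau> \<and> fst \<tau> 14 = of_bool (t \<in> A))"
    if "st A \<sigma>" for A \<sigma>
  proof (cases \<sigma>)
    case (Pair R' M')
    with that obtain B where *: "\<forall>i<12. R' i = R1 i" "M' = mem (set ?p) A B S'"
      by (auto simp: st_def)
    show ?thesis
      unfolding Pair target_in_A_def
      apply (simp only: wp_Seq)
      apply (rule wp_mono[OF runs_sum_addr[where n = n]])
      using * R1 cfgI[OF *(1)] graph by (auto simp: cfg_def st_def)
  qed
  have count: "runs count_neighbours \<sigma> (n * (n * 9 + 14) + n * 8 + 13)
      (\<lambda>\<tau>. st A \<tau> \<and> fst \<tau> 18 = Suc l - card (nb (set ?p) A))"
    if "st A \<sigma>" for A \<sigma>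
  proof (cases \<sigma>)
    case (Pair R' M')
    with that obtain B where *: "\<forall>i<12. R' i = R1 i" "M' = mem (set ?p) A B S'"
      by (auto simp: st_def)
    show ?thesis
      unfolding Pair count_neighbours_def *(2)
      apply (simp only: wp_Seq)
      apply (rule wp_mono[OF runs_neighbours[OF cfgI[OF *(1)]]])
      apply clarify
      apply (simp only: wp_atom)
      apply (rule wp_mono[OF runs_count_B])
      using cfgI[OF *(1)] *(1) R1 nb_subset by (auto simp: cfg_def st_def)
  qed
  have singleton: "runs singleton_A \<sigma> (n * 10 + 10) (st {v})" if "st A \<sigma>" for A \<sigma>
  proof (cases \<sigma>)
    case (Pair R' M')
    with that obtain B where *: "\<forall>i<12. R' i = R1 i" "M' = mem (set ?p) A B S'"
      by (auto simp: st_def)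
    show ?thesis
      unfolding Pair *(2)
      apply (rule wp_mono[OF runs_singleton_A[OF cfgI[OF *(1)]]])
      using * R1 v by (auto simp: st_def)
  qed
  have copy: "runs copy_U_to_A \<sigma> (n * 7 + 5) (st (set ?p))" if "st A \<sigma>" for A \<sigma>
  proof (cases \<sigma>)
    case (Pair R' M')
    with that obtain B where *: "\<forall>i<12. R' i = R1 i" "M' = mem (set ?p) A B S'"
      by (auto simp: st_def)
    show ?thesis
      unfolding Pair *(2)
      apply (rule wp_mono[OF runs_copy_U_to_A[OF cfgI[OF *(1)]]])
      using * by (auto simp: st_def)
  qed
  have search: "runs search \<sigma> (n * (n * (n * 9) + n * 22 + 15) + 3)
      (st (ball (set ?p) v (min n (k - length ?p))))" if "st {v} \<sigma>" for \<sigma>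
  proof (cases \<sigma>)
    case (Pair R' M')
    with that obtain B where *: "\<forall>i<12. R' i = R1 i" "M' = mem (set ?p) {v} B S'"
      by (auto simp: st_def)
    show ?thesis
      unfolding Pair *(2)
      apply (rule wp_mono[OF runs_search[OF cfgI[OF *(1)]]])
      using * R1 by (auto simp: st_def)
  qed
  have push: "runs push (R, M) (3 * n + 9) (st A)"
    unfolding push_def M
    apply simp
    apply (rule wp_mono[OF runs_sum_addr[where n = n]])
    using R v cfg S by (auto simp: st_def R1_def cfg_def mem_upd mem_upd_bool S'_def)
  have rem: "fst \<sigma> 3 = k - length ?p" "fst \<sigma> 1 = n" if "st A \<sigma>" for A \<sigma>
    using that R1 cfg1 by (auto simp: st_def cfg_def)
  define post where "post \<tau> \<longleftrightarrow> (if good ?p then found \<tau>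
      else rep ?p v (if expand ?p then n else 0) \<tau>)" for \<tau>
  have postI: "post ((fst \<tau>)(9 := if expand ?p then n else 0), snd \<tau>)" if "st A \<tau>" "\<not> good ?p" for A \<tau>
    using repI[of A "fst \<tau>" "snd \<tau>"] that unfolding post_def by simp
  have post_found: "post ((fst \<tau>)(11 := 1, 10 := 0), snd \<tau>)" if "good ?p" for \<tau>
    using that unfolding post_def found_def by simp
  have wp_atom': "wp (Dec i) \<tau> Q \<longleftrightarrow> Q 1 ((fst \<tau>)(i := fst \<tau> i - 1), snd \<tau>)"
    "wp (Const i a) \<tau> Q \<longleftrightarrow> Q 1 ((fst \<tau>)(i := a), snd \<tau>)"
    "wp (Copy i j) \<tau> Q \<longleftrightarrow> Q 1 ((fst \<tau>)(i := fst \<tau> j), snd \<tau>)" for i a j \<tau> Q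
    by (cases \<tau>; simp)+
  have end_of_path: "runs (copy_U_to_A;; count_neighbours;; Dec 18;; Cond 18 (Const 9 0) accept) \<sigma>
      (n * 7 + 5 + (n * (n * 9 + 14) + n * 8 + 13) + 4) post" if "st A \<sigma>" "v = t" for A \<sigma>
  proof -
    have st18: "st (set ?p) ((fst \<tau>)(18 := x), snd \<tau>)" if "st (set ?p) \<tau>" for \<tau> x
      using that by (auto simp: st_def)
    have good: "good ?p \<longleftrightarrow> l \<le> card (nb (set ?p) (set ?p))"
      unfolding good_def using \<open>v = t\<close> by simp
    have "\<not> expand ?p"
      unfolding expand_def using \<open>v = t\<close> by simp
    show ?thesis
      apply (simp only: wp_Seq)
      apply (rule wp_mono[OF copy[OF that(1)]])
      apply (elim conjE)
      apply (rule wp_mono[OF count], assumption)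
      apply (elim conjE)
      using postI[OF st18] post_found[of "((fst \<tau>)(18 := 0), snd \<tau>)" for \<tau>] good \<open>\<not> expand ?p\<close>
      apply (simp add: wp_atom' accept del: set_append)
      done
  qed
  have inner_vertex: "runs (count_neighbours;; Cond 18 (Cond 3 (Copy 9 1) (Const 9 0))
          (search;; target_in_A;; Cond 14 accept (Const 9 0))) \<sigma>
      (n * (n * 9 + 14) + n * 8 + 13 + (n * (n * (n * 9) + n * 22 + 15) + 3) + (3 * n + 4) + 4) post"
    if "st {v} \<sigma>" "v \<noteq> t" for \<sigma>
  proof -
    let ?m = "card (nb (set ?p) {v})"
    have good: "good ?p \<longleftrightarrow> l < ?m \<and> t \<in> ball (set ?p) v (min n (k - length ?p))"
      unfolding good_def using \<open>v \<noteq> t\<close> by simp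
    have expand: "expand ?p \<longleftrightarrow> ?m \<le> l \<and> k - length ?p \<noteq> 0"
      unfolding expand_def using \<open>v \<noteq> t\<close> by auto
    show ?thesis
    proof (cases "l < ?m")
      case True
      have "\<not> expand ?p" using expand True by simp
      show ?thesis
        apply (simp only: wp_Seq wp_Cond)
        apply (rule wp_mono[OF count[OF that(1)]])
        apply (elim conjE)
        apply (subst if_not_P[of "fst \<tau> 18 \<noteq> 0" for \<tau>])
        using True apply simp
        apply (rule wp_mono[OF search], assumption)
        apply (elim conjE)
        apply (rule wp_mono[OF target], assumption)
        using postI post_found good True \<open>\<not> expand ?p\<close>
        apply (auto simp: wp_atom' accept simp del: set_append)
        done
    next
      case False
      then have "\<not> good ?p" using good by simp
      with False show ?thesis
        apply (simp only: wp_Seq wp_Cond)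
        apply (rule wp_mono[OF count[OF that(1)]])
        apply (elim conjE)
        apply (subst if_P[of "fst \<tau> 18 \<noteq> 0" for \<tau>])
        apply simp
        using postI expand rem
        apply (auto simp: wp_atom' simp del: set_append)
        done
    qed
  qed
  show ?thesis
    unfolding enter_def post_def[symmetric]
    apply (simp only: wp_Seq)
    apply (rule wp_mono[OF push])
    apply (elim conjE)
    apply (rule wp_mono[OF singleton], assumption)
    apply (elim conjE)
    apply (rule wp_mono[OF target], assumption)
    apply (elim conjE)
    apply (simp only: wp_Cond)
    apply (cases "v = t")
     apply (subst if_P[of "of_bool Q \<noteq> (0::nat)" for Q], simp)
     apply (rule wp_mono[OF end_of_path], assumption, assumption)
     apply (simp add: algebra_simps)
    apply (subst if_not_P[of "of_bool Q \<noteq> (0::nat)" for Q], simp)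
    apply (rule wp_mono[OF inner_vertex], assumption, assumption)
    apply (simp add: algebra_simps)
    done
qed

text \<open>The cost of \<open>next_candidate\<close> plus that of \<open>enter\<close>, plus 2 for
  the branch and the copy between them. A retreat is cheaper.\<close>

definition step_bound :: nat where
  "step_bound = n * (n * (n * 9) + n * 22 + 15) + n * (n * 18) + n * 77 + 93"

lemma runs_advance:
  assumes rep: "rep p v (Suc c) \<sigma>" and c: "c < n" and p: "v < n"
  shows "runs advance \<sigma> step_bound
    (\<lambda>\<tau>. if c \<notin> nb (set p) {v} then rep p v c \<tau>
         else if good (p @ [c]) then found \<tau>
         else rep (p @ [c]) c (if expand (p @ [c]) then n else 0) \<tau>)"
    (is "runs advance \<sigma> _ ?post")
proof -
  obtain R M where \<sigma>: "\<sigma> = (R, M)" by fastforce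
  from rep obtain A B S where cfg: "cfg R" and R: "R 2 = t" "R 3 = k - length p" "R 4 = l"
      "R 7 = N + 3 * n + length p" "R 8 = v" "R 9 = Suc c" "R 10 = length p" "R 11 = 0"
    and M: "M = mem (set p) A B S" and S: "\<forall>i<length p. S i = p ! i"
    unfolding \<sigma> rep_def by auto
  define R1 where "R1 = R(9 := c)"
  have cfg1: "cfg R'" if "\<forall>i<12. R' i = R1 i" for R'
    using cfg that by (simp add: R1_def cfg_def)
  \<comment> \<open>Register 8 is treated separately because the candidate is written into it before
    \<open>enter\<close> starts.\<close>
  have repI: "rep p v' c (R', mem (set p) A B S)" if "\<forall>i<12. i \<noteq> 8 \<longrightarrow> R' i = R1 i" "R' 8 = v'" for R' A B v'
    using that cfg R S by (auto simp: rep_def cfg_def R1_def)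
  have candidate: "runs next_candidate \<sigma>
      (n * (n * 9 + 14) + n * 13 + 21)
      (\<lambda>\<tau>. (\<forall>i<12. fst \<tau> i = R1 i) \<and> (\<exists>A B. snd \<tau> = mem (set p) A B S) \<and>
        fst \<tau> 14 = of_bool (c \<in> nb (set p) {v}))"
    unfolding \<sigma> M next_candidate_def
    apply (simp only: wp_Seq wp_atom)
    apply (rule wp_mono[OF runs_singleton_A])
    using cfg R p apply (simp add: cfg_def)
    using cfg R p apply simp
    apply clarify
    apply (rule wp_mono[OF runs_neighbours])
    using cfg R p apply (simp add: cfg_def)
    apply clarify
    apply (rule wp_mono[OF runs_sum_addr[where n = n]])
    using cfg R p c apply simp
    apply simp
    apply clarify
    using cfg R p c apply (auto simp: cfg_def R1_def)
    done
  have wp_Copy: "wp (Copy 8 9) \<tau> Q \<longleftrightarrow> Q 1 ((fst \<tau>)(8 := fst \<tau> 9), snd \<tau>)" for \<tau> Q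
    by (cases \<tau>) simp
  define post where "post \<tau> \<longleftrightarrow> ?post \<tau>" for \<tau>
  show ?thesis
    unfolding advance_def post_def[symmetric]
    apply (simp only: wp_Seq)
    apply (rule wp_mono[OF candidate])
    apply (elim conjE exE)
    subgoal for T \<tau> A' B'
    proof (cases "c \<in> nb (set p) {v}")
      case False
      moreover assume "T \<le> n * (n * 9 + 14) + n * 13 + 21" "\<forall>i<12. fst \<tau> i = R1 i"
        "fst \<tau> 14 = of_bool (c \<in> nb (set p) {v})" "snd \<tau> = mem (set p) A' B' S"
      moreover from this have "rep p v c \<tau>"
        using repI[of "fst \<tau>" v A' B'] R by (cases \<tau>) (simp add: R1_def)
      ultimately show ?thesis
        by (simp add: post_def step_bound_def algebra_simps)
    next
      case True
      assume *: "T \<le> n * (n * 9 + 14) + n * 13 + 21" "\<forall>i<12. fst \<tau> i = R1 i"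
        "fst \<tau> 14 = of_bool (c \<in> nb (set p) {v})" "snd \<tau> = mem (set p) A' B' S"
      then have "rep p c c ((fst \<tau>)(8 := fst \<tau> 9), snd \<tau>)"
        using repI[of "(fst \<tau>)(8 := fst \<tau> 9)" c A' B'] by (simp add: R1_def)
      from runs_enter[OF this c] have "runs enter ((fst \<tau>)(8 := fst \<tau> 9), snd \<tau>)
          (n * (n * (n * 9) + n * 22 + 15) + n * (n * 9) + n * 50 + 70) post"
        using True by (simp add: post_def[abs_def])
      then show ?thesis
        using True * by (simp add: wp_Copy) (erule wp_mono, auto simp: step_bound_def algebra_simps)
    qed
    done
qed

text \<open>When \<open>q\<close> is empty, the cell below the stack is loaded into register 8. This
  is harmless, since the path length is then zero and the main loop stops; hence the condition on
  the last conjunct.\<close>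

lemma runs_retreat:
  assumes rep: "rep (q @ [v]) v 0 \<sigma>" and v: "v < n" "v \<notin> set q" "length q < k"
  shows "runs retreat \<sigma> (3 * n + 12) (\<lambda>\<tau>. rep q (fst \<tau> 8) v \<tau> \<and> (q \<noteq> [] \<longrightarrow> fst \<tau> 8 = last q))"
proof -
  obtain R M A B S where \<sigma>: "\<sigma> = (R, M)" and cfg: "cfg R" and R: "R 2 = t" "R 3 = k - Suc (length q)" "R 4 = l"
      "R 7 = N + 3 * n + Suc (length q)" "R 8 = v" "R 9 = 0" "R 10 = Suc (length q)" "R 11 = 0"
    and M: "M = mem (insert v (set q)) A B S" and S: "\<And>i. i < Suc (length q) \<Longrightarrow> S i = (q @ [v]) ! i"
    using rep unfolding rep_def by (cases \<sigma>) auto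
  have S': "S i = q ! i" if "i < length q" for i
    using S[of i] that by (simp add: nth_append)
  have last: "S (length q - Suc 0) = last q" if "q \<noteq> []"
    using S'[of "length q - Suc 0"] that by (simp add: last_conv_nth)
  have M': "M(N + v := 0) = mem (set q) A B S"
    unfolding M using v by (simp add: mem_upd_bool)
  have top: "mem (set q) A B S (N + 3 * n + length q - Suc 0) = last q" if "q \<noteq> []"
  proof -
    have "N + 3 * n + length q - Suc 0 = N + 3 * n + (length q - Suc 0)"
      using that by (cases q) auto
    then show ?thesis using last[OF that] by simp
  qed
  show ?thesis
    unfolding \<sigma> retreat_def
    apply (simp only: wp_Seq)
    apply (rule wp_mono[OF runs_sum_addr[where n = n]])
    using R cfg v S' M' top by (auto simp: rep_def cfg_def)
qed

text \<open>Success of the search from a node, stated without the machine. It separates the two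
  halves of the proof: the program decides \<open>hit [s]\<close>, and \<open>hit [s]\<close> is
  equivalent to the existence of a solution.\<close>

inductive hit :: "nat list \<Rightarrow> bool" where
  good: "good p \<Longrightarrow> hit p"
| child: "expand p \<Longrightarrow> x \<in> nb (set p) {last p} \<Longrightarrow> hit (p @ [x]) \<Longrightarrow> hit p"

definition path_prefix :: "nat list \<Rightarrow> bool" where
  "path_prefix p \<longleftrightarrow> distinct p \<and> set p \<subseteq> {..<n} \<and> length p \<le> k \<and> p \<noteq> []"

section \<open>Running time of a subtree\<close>

lemma runs_main_step:
  assumes "rep p v c \<sigma>" "p \<noteq> []"
    and "runs (if c = 0 then retreat else advance) \<sigma> step_bound (\<lambda>\<tau>. runs main_loop \<tau> B Q)"
  shows "runs main_loop \<sigma> (step_bound + 2 + B) Q"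
proof -
  have *: "fst \<sigma> 10 \<noteq> 0" "fst \<sigma> 9 = c"
    using assms by (auto simp: rep_def split: prod.splits)
  \<comment> \<open>The 2 in the bound pays for the tests of \<open>Cond\<close> and
    \<open>While\<close>.\<close>
  have "runs (Cond 9 advance retreat) \<sigma> (Suc step_bound) (\<lambda>\<tau>. runs main_loop \<tau> B Q)"
    using assms(3) * by (auto elim!: wp_mono split: if_splits)
  from runs_While[OF *(1) this[unfolded main_loop_def]] show ?thesis
    unfolding main_loop_def by (auto elim!: wp_mono)
qed

text \<open>Solves \<open>F (r + 1) \<ge> (n + 1) * (step_bound + 2) + l * F r\<close>, the recurrence for a search tree
  node with remaining budget \<open>r + 1\<close>.\<close>

definition node_bound :: "nat \<Rightarrow> nat" where
  "node_bound r = (n + 1) * (step_bound + 2) * (l + 1) ^ r"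

text \<open>Continuation style: \<open>B\<close> and \<open>Q\<close> describe the run after the
  subtree of \<open>q\<close> has been left, either by acceptance or by a retreat that makes
  \<open>last q\<close> the cursor of its parent. Each exit is tied to the truth value of
  \<open>hit q\<close>, so correctness travels along with the time. A parent instantiates
  \<open>B\<close> by the cost of its remaining candidates, and the induction on the remaining
  budget adds up.\<close>

lemma runs_node:
  assumes "rep q (last q) (if expand q then n else 0) \<sigma>" "path_prefix q" "\<not> good q"
    and "hit q \<Longrightarrow> \<forall>\<tau>. found \<tau> \<longrightarrow> runs main_loop \<tau> B Q"
    and "\<not> hit q \<Longrightarrow> \<forall>\<tau> w. rep (butlast q) w (last q) \<tau> \<longrightarrow> (butlast q \<noteq> [] \<longrightarrow> w = last (butlast q)) \<longrightarrow>
      runs main_loop \<tau> B Q"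
  shows "runs main_loop \<sigma> (node_bound (k - length q) + B) Q"
  using assms
proof (induction "k - length q" arbitrary: q \<sigma> B rule: less_induct)
  case less
  define v where "v = last q"
  define F where "F = node_bound (k - length q - 1)"
  let ?b = "step_bound + 2"
  have q: "distinct q" "set q \<subseteq> {..<n}" "length q \<le> k" "q \<noteq> []"
    using less.prems(2) unfolding path_prefix_def by auto
  then have v: "v < n"
    using last_in_set[of q] unfolding v_def by blast
  have snoc: "q = butlast q @ [v]"
    using q unfolding v_def by simp
  have pop: "runs main_loop \<tau> (?b + B) Q" if "rep q v 0 \<tau>" "\<not> hit q" for \<tau>
  proof (rule runs_main_step[OF that(1) \<open>q \<noteq> []\<close>])
    have "v \<notin> set (butlast q)" "length (butlast q) < k"
      using q snoc by (metis distinct_butlast distinct.simps(2) not_distinct_conv_prefix)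
        (use q in \<open>cases q; simp\<close>)
    then have "runs retreat \<tau> (3 * n + 12) (\<lambda>\<tau>. rep (butlast q) (fst \<tau> 8) v \<tau> \<and>
        (butlast q \<noteq> [] \<longrightarrow> fst \<tau> 8 = last (butlast q)))"
      using that snoc v by (intro runs_retreat) auto
    then show "runs (if 0 = 0 then retreat else advance) \<tau> step_bound (\<lambda>\<tau>. runs main_loop \<tau> B Q)"
      using less.prems(5)[OF that(2)] by (auto elim!: wp_mono simp: step_bound_def v_def)
  qed
  show ?case
  proof (cases "expand q")
    case False
    then have "\<not> hit q"
      using less.prems(3) by (auto elim: hit.cases)
    have "1 * ?b * 1 \<le> (n + 1) * ?b * (l + 1) ^ (k - length q)"
      by (intro mult_mono) auto
    then have "?b \<le> node_bound (k - length q)"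
      unfolding node_bound_def by simp
    then show ?thesis
      using pop[OF _ \<open>\<not> hit q\<close>, of \<sigma>] less.prems(1) False
      by (auto elim!: wp_mono simp: v_def)
  next
    case True
    then have r: "k - length q = Suc (k - length q - 1)" "length q < k"
      unfolding expand_def by auto
    let ?C = "nb (set q) {v}"
    have hit: "hit q \<longleftrightarrow> (\<exists>x\<in>?C. hit (q @ [x]))"
      using True less.prems(3) by (auto elim: hit.cases intro: hit.child simp: v_def)
    \<comment> \<open>All children at or above the cursor have failed. Each of the \<open>c\<close>
      candidates left costs at most \<open>?b\<close>, each actual child among them a further
      \<open>F\<close> for its subtree, and the closing retreat another \<open>?b\<close>.\<close>
    have scan: "runs main_loop \<tau> (c * ?b + card {x \<in> ?C. x < c} * F + (?b + B)) Q"
      if "rep q v c \<tau>" "c \<le> n" "\<forall>x\<in>?C. c \<le> x \<longrightarrow> \<not> hit (q @ [x])" for c \<tau>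
      using that
    proof (induction c arbitrary: \<tau>)
      case 0
      then show ?case
        using pop[of \<tau>] hit by auto
    next
      case (Suc c)
      define B' where "B' = c * ?b + card {x \<in> ?C. x < c} * F + (?b + B)"
      have IH: "runs main_loop \<tau>' B' Q" if "rep q v c \<tau>'" "c \<in> ?C \<longrightarrow> \<not> hit (q @ [c])" for \<tau>'
        unfolding B'_def
      proof (rule Suc.IH[OF that(1)])
        show "\<forall>x\<in>?C. c \<le> x \<longrightarrow> \<not> hit (q @ [x])"
          using Suc.prems(3) that(2) by (metis Suc_leI le_neq_implies_less)
      qed (use Suc.prems in simp)
      have cont: "runs main_loop \<tau>' B' Q" if "found \<tau>'" "hit q" for \<tau>'
      proof -
        have "runs main_loop \<tau>' B Q" using less.prems(4) that by blast
        then show ?thesis unfolding B'_def by (auto elim!: wp_mono)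
      qed
      have card: "card {x \<in> ?C. x < Suc c} = card {x \<in> ?C. x < c} + (if c \<in> ?C then 1 else 0)"
      proof -
        have "{x \<in> ?C. x < Suc c} = (if c \<in> ?C then insert c {x \<in> ?C. x < c} else {x \<in> ?C. x < c})"
          by (auto simp: less_Suc_eq)
        then show ?thesis by simp
      qed
      let ?B = "B' + (if c \<in> ?C then F else 0)"
      have "runs main_loop \<tau> (?b + ?B) Q"
      proof (rule runs_main_step[OF Suc.prems(1) \<open>q \<noteq> []\<close>],
          subst if_not_P, simp, rule wp_mono[OF runs_advance[OF Suc.prems(1)]], goal_cases)
        case (3 T \<tau>')
        consider "c \<notin> ?C" "rep q v c \<tau>'" | "c \<in> ?C" "good (q @ [c])" "found \<tau>'"
          | "c \<in> ?C" "\<not> good (q @ [c])" "rep (q @ [c]) c (if expand (q @ [c]) then n else 0) \<tau>'"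
          using 3 by (auto split: if_splits)
        then have "runs main_loop \<tau>' ?B Q"
        proof cases
          case 1
          then show ?thesis using IH by simp
        next
          case 2
          then have "hit q" using hit by (auto intro: hit.good)
          then have "runs main_loop \<tau>' B' Q" using cont 2 by simp
          then show ?thesis by (auto elim!: wp_mono)
        next
          case 3
          have "c < n" "c \<notin> set q" using \<open>c \<in> ?C\<close> by (auto simp: nb_def)
          then have "path_prefix (q @ [c])"
            using q r by (auto simp: path_prefix_def)
          \<comment> \<open>The induction hypothesis for the child, with the rest of this scan, of
            cost \<open>B'\<close>, as its continuation.\<close>
          then have "runs main_loop \<tau>' (node_bound (k - length (q @ [c])) + B') Q"
            using 3 r cont IH hit \<open>q \<noteq> []\<close>
            by (intro less.hyps) (auto simp flip: v_def)
          then show ?thesis using 3 by (simp add: F_def add.commute)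
        qed
        then show ?case using 3 by simp
      qed (use Suc.prems v in auto)
      then show ?case
        unfolding B'_def card by (auto simp: algebra_simps)
    qed
    have "card {x \<in> ?C. x < n} \<le> l"
    proof -
      have "{x \<in> ?C. x < n} = ?C" using nb_subset by auto
      then show ?thesis using True by (simp add: expand_def v_def)
    qed
    then have "n * ?b + card {x \<in> ?C. x < n} * F + ?b \<le> n * ?b + l * F + ?b"
      by simp
    also have "\<dots> \<le> node_bound (k - length q)"
    proof -
      have "(n + 1) * ?b * 1 \<le> (n + 1) * ?b * (l + 1) ^ (k - length q - 1)"
        by (intro mult_left_mono) auto
      then show ?thesis
        unfolding F_def node_bound_def by (subst (2) r(1)) (simp add: algebra_simps)
    qed
    finally have "n * ?b + card {x \<in> ?C. x < n} * F + (?b + B) \<le> node_bound (k - length q) + B"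
      by simp
    moreover have "rep q v n \<sigma>" using less.prems(1) True by (simp add: v_def)
    then have "runs main_loop \<sigma> (n * ?b + card {x \<in> ?C. x < n} * F + (?b + B)) Q"
      by (rule scan) (auto simp: nb_def)
    ultimately show ?thesis
      by (auto elim!: wp_mono)
  qed
qed

section \<open>Paths and the search tree\<close>

abbreviation adj :: "nat \<Rightarrow> nat \<Rightarrow> bool" where
  "adj u v \<equiv> {u, v} \<in> edges G"

text \<open>Walks suffice here; repetitions are removed later by minimality. Only \<open>Q\<close>
  has to avoid \<open>U\<close>, because in the application \<open>v\<close> is the last vertex of
  the path \<open>U\<close>.\<close>

lemma ball_iff:
  assumes "v < n"
  shows "x \<in> ball U v r \<longleftrightarrow>
    (\<exists>Q. length Q \<le> r \<and> last (v # Q) = x \<and> successively adj (v # Q) \<and> set Q \<subseteq> {..<n} - U)"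
    (is "_ \<longleftrightarrow> (\<exists>Q. ?walk r x Q)")
proof (induction r arbitrary: x)
  case 0
  then show ?case by auto
next
  case (Suc r)
  show ?case
  proof
    assume "x \<in> ball U v (Suc r)"
    then consider "x \<in> ball U v r" | i where "i \<in> ball U v r" "x < n" "x \<notin> U" "adj x i"
      by (auto simp: nb_def)
    then show "\<exists>Q. ?walk (Suc r) x Q"
    proof cases
      case 1
      then show ?thesis using Suc.IH[of x] le_Suc_eq by blast
    next
      case 2
      then obtain Q where "?walk r i Q" using Suc.IH by blast
      with 2 have "?walk (Suc r) x (Q @ [x])"
        using successively_append_iff[of adj "v # Q" "[x]"] by (auto simp: insert_commute)
      then show ?thesis by blast
    qed
  next
    assume "\<exists>Q. ?walk (Suc r) x Q"
    then obtain Q where Q: "?walk (Suc r) x Q" by blast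
    show "x \<in> ball U v (Suc r)"
    proof (cases "length Q \<le> r")
      case True
      then have "x \<in> ball U v r" using Suc.IH Q by blast
      then show ?thesis by simp
    next
      case False
      then obtain Q' y where Q': "Q = Q' @ [y]" by (cases Q rule: rev_cases) auto
      define i where "i = last (v # Q')"
      have suc: "successively adj (v # Q')" "adj i x"
        using Q successively_append_iff[of adj "v # Q'" "[y]"] unfolding Q' i_def by auto
      then have "i \<in> ball U v r"
        using Suc.IH[of i] Q unfolding Q' i_def by auto
      moreover have "i < n"
        using Q assms last_in_set[of "v # Q'"] unfolding Q' i_def by auto
      ultimately show ?thesis
        using suc Q unfolding Q' by (auto simp: nb_def insert_commute)
    qed
  qed
qed

definition solution :: "nat list \<Rightarrow> bool" where
  "solution P \<longleftrightarrow> path_prefix P \<and> successively adj P \<and> last P = t \<and> l \<le> card (nb (set P) (set P))"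

text \<open>On a shortest path to \<open>t\<close> outside \<open>p\<close> only the first vertex is adjacent to \<open>last p\<close>, so at most
  one of its \<open>l + 1\<close> unused neighbours gets lost.\<close>

lemma good_imp_solution:
  assumes p: "path_prefix p" "successively adj p" and good: "good p"
  shows "\<exists>Q. solution (p @ Q)"
proof (cases "last p = t")
  case True
  then have "solution (p @ [])"
    using assms by (simp add: solution_def good_def)
  then show ?thesis by blast
next
  case False
  define v where "v = last p"
  let ?walk = "\<lambda>Q. last (v # Q) = t \<and> successively adj (v # Q) \<and> set Q \<subseteq> {..<n} - set p"
  have p': "distinct p" "set p \<subseteq> {..<n}" "length p \<le> k" "p \<noteq> []"
    using p unfolding path_prefix_def by auto
  then have v: "v < n" "v \<in> set p" using last_in_set[of p] unfolding v_def by blast+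
  from good False have l: "l < card (nb (set p) {v})" and "t \<in> ball (set p) v (min n (k - length p))"
    by (auto simp: good_def v_def)
  then obtain Q' where Q': "?walk Q'" "length Q' \<le> k - length p"
    using ball_iff[OF v(1)] by auto
  \<comment> \<open>The minimum is taken over walks of every length; comparison with
    \<open>Q'\<close> then keeps it within the budget.\<close>
  define Q where "Q = arg_min length ?walk"
  have Q: "?walk Q" and min: "length Q \<le> length W" if "?walk W" for W
    using arg_min_nat_lemma[of ?walk Q' length] Q'(1) that unfolding Q_def by blast+
  note Q = Q[OF Q'(1)]
  have len: "length Q \<le> k - length p" using min[OF Q'(1)] Q'(2) by simp
  have "Q \<noteq> []" using Q False by (auto simp: v_def)
  \<comment> \<open>Cutting out the part between two occurrences of a vertex would give a shorter
    walk.\<close>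
  have "distinct Q"
  proof (rule ccontr)
    assume "\<not> distinct Q"
    then obtain a y b c where "Q = a @ [y] @ b @ [y] @ c" using not_distinct_decomp by blast
    moreover from this have "?walk (a @ [y] @ c)"
      using Q successively_append_iff[of adj "v # a @ [y] @ b" "[y] @ c"]
        successively_append_iff[of adj "v # a @ [y]" b] successively_append_iff[of adj "v # a" "[y]"]
        successively_append_iff[of adj "v # a" "[y] @ c"]
      by auto
    ultimately show False using min[of "a @ [y] @ c"] by simp
  qed
  \<comment> \<open>The part of \<open>Q\<close> from a neighbour of \<open>v\<close> on is itself a
    walk to \<open>t\<close> after \<open>v\<close>, so by minimality it is all of
    \<open>Q\<close>.\<close>
  have hd: "x = hd Q" if "x \<in> set Q" "adj v x" for x
  proof -
    from that obtain a c where Qac: "Q = a @ x # c" by (meson split_list)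
    then have "?walk (x # c)"
      using Q that successively_append_iff[of adj "v # a" "x # c"] by auto
    from min[OF this] Qac show ?thesis by simp
  qed
  have "nb (set p) {v} - {hd Q} \<subseteq> nb (set (p @ Q)) (set (p @ Q))"
    using hd v by (auto simp: nb_def insert_commute)
  then have "card (nb (set p) {v} - {hd Q}) \<le> card (nb (set (p @ Q)) (set (p @ Q)))"
    by (intro card_mono) auto
  moreover have "card (nb (set p) {v}) - 1 \<le> card (nb (set p) {v} - {hd Q})"
    by (simp add: card_Diff_singleton_if)
  ultimately have "l \<le> card (nb (set (p @ Q)) (set (p @ Q)))"
    using l by linarith
  moreover have "successively adj (p @ Q)"
    using p(2) Q \<open>Q \<noteq> []\<close> p'(4) by (cases Q) (auto simp: successively_append_iff v_def)
  ultimately have "solution (p @ Q)"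
    using p' Q \<open>distinct Q\<close> \<open>Q \<noteq> []\<close> len unfolding solution_def path_prefix_def by auto
  then show ?thesis by blast
qed

lemma hit_imp_solution:
  assumes "hit p" "path_prefix p" "successively adj p"
  shows "\<exists>Q. solution (p @ Q)"
  using assms
proof (induction rule: hit.induct)
  case (good p)
  then show ?case using good_imp_solution by blast
next
  case (child p x)
  have "path_prefix (p @ [x])"
    using child by (auto simp: path_prefix_def expand_def nb_def)
  moreover have "successively adj (p @ [x])"
    using child by (auto simp: successively_append_iff nb_def insert_commute)
  ultimately obtain Q where "solution ((p @ [x]) @ Q)" using child.IH by blast
  then show ?case by (metis append.assoc)
qed

text \<open>The search need not find the given solution. It follows the solution while nodes are
  expanded; at the first vertex with more than \<open>l\<close> free neighbours, the rest of the
  solution merely certifies that \<open>t\<close> is close enough, which makes that node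
  \<open>good\<close>.\<close>

lemma solution_imp_hit:
  assumes "solution (p @ Q)" "p \<noteq> []"
  shows "hit p"
  using assms
proof (induction Q arbitrary: p)
  case Nil
  then show ?case
    by (intro hit.good) (simp add: solution_def good_def)
next
  case (Cons x Q)
  define v where "v = last p"
  have sol: "distinct (p @ x # Q)" "set (p @ x # Q) \<subseteq> {..<n}" "length (p @ x # Q) \<le> k"
    "successively adj (p @ x # Q)" "last (x # Q) = t"
    using Cons.prems by (auto simp: solution_def path_prefix_def)
  have v: "v \<in> set p" using Cons.prems(2) unfolding v_def by simp
  then have v: "v \<in> set p" "v < n" using sol(2) by auto
  have "t \<in> set (x # Q)" using sol(5) last_in_set[of "x # Q"] by simp
  then have "v \<noteq> t" using v sol(1) by auto
  have suc: "successively adj (v # x # Q)"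
    using sol(4) Cons.prems(2) by (auto simp: successively_append_iff v_def)
  then have x: "x \<in> nb (set p) {v}"
    using sol v by (auto simp: nb_def insert_commute)
  show ?case
  proof (cases "card (nb (set p) {v}) \<le> l")
    case True
    then have "expand p"
      using \<open>v \<noteq> t\<close> sol(3) by (simp add: expand_def v_def)
    moreover have "hit (p @ [x])"
      using Cons.IH[of "p @ [x]"] Cons.prems by simp
    ultimately show ?thesis
      using x hit.child[of p x] by (simp add: v_def)
  next
    case False
    \<comment> \<open>A simple path has at most \<open>n\<close> vertices, so capping the radius at
      \<open>n\<close> loses nothing.\<close>
    have "card (set (x # Q)) \<le> card {..<n}"
      using sol(2) by (intro card_mono) auto
    then have "length (x # Q) \<le> n"
      using sol(1) distinct_card[of "x # Q"] by simp
    then have "t \<in> ball (set p) v (min n (k - length p))"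
      unfolding ball_iff[OF v(2)]
      by (intro exI[of _ "x # Q"]) (use sol suc in auto)
    then have "good p"
      using False \<open>v \<noteq> t\<close> by (simp add: good_def v_def)
    then show ?thesis by (rule hit.good)
  qed
qed

lemma open_nbhd_eq_nb: "W \<subseteq> {..<n} \<Longrightarrow> open_nbhd G W = nb W W"
  unfolding open_nbhd_def nb_def graph(1) by auto

lemma hit_iff: "hit [s] \<longleftrightarrow> short_unsecluded_path (G, s, t, k, l)"
proof -
  have "hit [s] \<longleftrightarrow> (\<exists>Q. solution ([s] @ Q))"
    using hit_imp_solution[of "[s]"] solution_imp_hit[of "[s]"] graph by (auto simp: path_prefix_def)
  also have "\<dots> \<longleftrightarrow> (\<exists>P. hd P = s \<and> solution P)"
    by (metis append_Cons append_Nil hd_Cons_tl list.sel(1) path_prefix_def solution_def)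
  also have "\<dots> \<longleftrightarrow> short_unsecluded_path (G, s, t, k, l)"
    using open_nbhd_eq_nb
    by (auto simp: short_unsecluded_path_def simple_path_def solution_def path_prefix_def graph(1)
        distinct_card)
  finally show ?thesis .
qed

section \<open>Initialization and total running time\<close>

lemma initial_state: "initial_state input = ((\<lambda>_. 0)(0 := N), mem {} {} {} (\<lambda>_. 0))"
  by (auto simp: initial_state_def length_input mem_def fun_eq_iff)

text \<open>Register 14 starts at 0 and serves as the input pointer. The arrays are empty from the
  start, as memory beyond the input is zero. Register 8 receives \<open>s\<close>, the first vertex
  to be pushed.\<close>

lemma runs_init: "runs init (initial_state input) (n * 9 + 21) (rep [] s 0)"
proof -
  have N: "0 < N" "Suc 0 < N" "2 < N" "3 < N" "4 < N" by (auto simp: N_def)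
  have input: "input ! 0 = n" "input ! 1 = s" "input ! Suc 0 = s" "input ! 2 = t" "input ! 3 = k" "input ! 4 = l"
    using input_nth by auto
  have *: "Suc (Suc 0) = 2" "Suc 2 = 3" "Suc 3 = 4" by auto
  show ?thesis
    unfolding init_def initial_state
    apply (simp add: N input *)
    apply (rule wp_mono[OF runs_sum_addr[where n = n]], simp, simp)
    apply simp
    apply (rule wp_mono[OF runs_sum_addr[where n = n]], simp, simp)
    apply simp
    apply (rule wp_mono[OF runs_sum_addr[where n = n]], simp, simp)
    apply (auto simp: rep_def cfg_def)
    done
qed

lemma decides_decide:
  "decides_within decide input (short_unsecluded_path (G, s, t, k, l))
     (1000 * (l + 1) ^ k * n ^ 4)"
proof -
  define Q where "Q \<tau> \<longleftrightarrow> (fst \<tau> 11 \<noteq> 0 \<longleftrightarrow> hit [s])" for \<tau> :: state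
  have end_loop: "runs main_loop \<tau> 1 Q" if "fst \<tau> 10 = 0" "Q \<tau>" for \<tau>
    unfolding main_loop_def by (rule wp_While_end) (use that in auto)
  have loop: "runs main_loop \<tau> (node_bound (k - 1) + 1) Q"
    if "if good ([] @ [s]) then found \<tau> else rep ([] @ [s]) s (if expand ([] @ [s]) then n else 0) \<tau>" for \<tau>
  proof (cases "good [s]")
    case True
    then have "runs main_loop \<tau> 1 Q"
      using that by (intro end_loop) (auto simp: found_def Q_def intro: hit.good)
    then show ?thesis by (auto elim!: wp_mono)
  next
    case False
    have "runs main_loop \<tau> (node_bound (k - length [s]) + 1) Q"
    proof (rule runs_node)
      show "rep [s] (last [s]) (if expand [s] then n else 0) \<tau>" using that False by simp
      show "path_prefix [s]" using graph by (simp add: path_prefix_def)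
      show "\<forall>\<tau>. found \<tau> \<longrightarrow> runs main_loop \<tau> 1 Q" if "hit [s]"
        by (intro allI impI end_loop) (use that in \<open>auto simp: found_def Q_def\<close>)
      show "\<forall>\<tau> w. rep (butlast [s]) w (last [s]) \<tau> \<longrightarrow> (butlast [s] \<noteq> [] \<longrightarrow> w = last (butlast [s])) \<longrightarrow>
          runs main_loop \<tau> 1 Q" if "\<not> hit [s]"
        by (intro allI impI end_loop) (use that in \<open>auto simp: rep_def Q_def\<close>)
    qed (fact False)
    then show ?thesis by simp
  qed
  define e where "e = n * (n * (n * 9) + n * 22 + 15) + n * (n * 9) + n * 50 + 70"
  have "runs decide (initial_state input) (n * 9 + 21 + (e + (node_bound (k - 1) + 1 + 1)))
      (\<lambda>\<tau>. fst \<tau> 0 \<noteq> 0 \<longleftrightarrow> hit [s])"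
  proof -
    have enter: "runs enter \<tau> e (\<lambda>\<tau>. runs main_loop \<tau> (node_bound (k - 1) + 1) Q)" if "rep [] s 0 \<tau>" for \<tau>
      using runs_enter[of "[]" s 0 "fst \<tau>" "snd \<tau>"] that graph loop unfolding e_def by (auto elim!: wp_mono)
    show ?thesis
      unfolding decide_def
      apply (simp only: wp_Seq)
      apply (rule wp_mono[OF runs_init])
      apply (elim conjE)
      apply (rule wp_mono[OF enter], assumption)
      apply (elim conjE)
      apply (erule wp_mono)
      apply (auto simp: Q_def)
      done
  qed
  then have "decides_within decide input (hit [s]) (n * 9 + 21 + (e + (node_bound (k - 1) + 1 + 1)))"
    unfolding decides_within_def wp_def by blast
  moreover have "n * 9 + 21 + (e + (node_bound (k - 1) + 1 + 1)) \<le> 1000 * (l + 1) ^ k * n ^ 4"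
  proof -
    define L where "L = (l + 1) ^ k"
    have n: "1 \<le> n" using graph(2) by simp
    then have pow: "1 \<le> n ^ 3" "n \<le> n ^ 3" "n ^ 2 \<le> n ^ 3"
      using self_le_power[of n 3] power_increasing[of 2 3 n] by auto
    \<comment> \<open>As \<open>n\<close> is positive, lower powers are raised to
      \<open>n ^ 3\<close> and the coefficients add up: 9 + 40 + 92 + 95 = 236, and similarly 207
      below. The total 2 * 236 + 207 stays below 1000.\<close>
    have "step_bound + 2 = 9 * n ^ 3 + 40 * n ^ 2 + 92 * n + 95"
      unfolding step_bound_def by (simp add: algebra_simps power2_eq_square power3_eq_cube)
    then have "step_bound + 2 \<le> 236 * n ^ 3" using pow by linarith
    moreover have "(l + 1) ^ (k - 1) \<le> L"
      unfolding L_def by (intro power_increasing) auto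
    moreover have "n + 1 \<le> 2 * n" using n by simp
    ultimately have "node_bound (k - 1) \<le> (2 * n) * (236 * n ^ 3) * L"
      unfolding node_bound_def by (intro mult_mono) auto
    also have "\<dots> = 472 * L * n ^ 4" by (simp add: power4_eq_xxxx power3_eq_cube)
    finally have "node_bound (k - 1) \<le> 472 * L * n ^ 4" .
    moreover have "n * 9 + 21 + (e + 2) = 9 * n ^ 3 + 31 * n ^ 2 + 74 * n + 93"
      unfolding e_def by (simp add: algebra_simps power2_eq_square power3_eq_cube)
    then have "n * 9 + 21 + (e + 2) \<le> 207 * n ^ 3" using pow by linarith
    moreover have "1 * n ^ 3 \<le> L * n ^ 4"
      using n by (intro mult_mono power_increasing) (auto simp: L_def)
    ultimately show ?thesis unfolding L_def[symmetric] by simp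
  qed
  ultimately show ?thesis
    unfolding hit_iff decides_within_def by (meson order_trans)
qed

end

section \<open>Computability of the parameter function and tractability\<close>

lemma length_le_input_size: "length xs \<le> input_size xs"
  unfolding input_size_def by (induction xs) auto

text \<open>Iterated multiplication by the base in register 3, with the power so far in register 4.
  Each product is accumulated in register 5 by repeated addition.\<close>

definition power_com :: com where
  "power_com = Const 1 0;; Load 2 1;; Copy 3 2;; Inc 3;; Const 4 1;;
     While 2 (Const 5 0;; Copy 6 3;;
       While 6 (Copy 7 4;; While 7 (Inc 5;; Dec 7);; Dec 6);; Copy 4 5;; Dec 2);;
     Copy 0 4"

lemma computable_power: "computable (\<lambda>p. (p + 1) ^ p)"
proof -
  have "wp power_com (initial_state [p]) (\<lambda>T \<tau>. fst \<tau> 0 = (p + 1) ^ p)" for p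
  proof -
    let ?add = "While 7 (Inc 5;; Dec 7)"
    let ?mult = "While 6 (Copy 7 4;; ?add;; Dec 6)"
    let ?pow = "While 2 (Const 5 0;; Copy 6 3;; ?mult;; Copy 4 5;; Dec 2)"
    have add: "wp ?add (R, M) (\<lambda>T \<tau>. \<tau> = (R(5 := R 5 + R 7, 7 := 0), M))" for R M
    proof -
      have "wp ?add (R, M) (\<lambda>T \<tau>. \<tau> = (R(5 := R 5 + R 7, 7 := R 7 - R 7), M))"
        by (rule wp_loop[where N = "R 7" and I = "\<lambda>m t \<tau>. \<tau> = (R(5 := R 5 + m, 7 := R 7 - m), M)", THEN wp_mono])
          (auto simp: fun_eq_iff)
      then show ?thesis by simp
    qed
    have mult: "wp ?mult (R, M) (\<lambda>T (R', M'). R' 5 = R 5 + R 6 * R 4 \<and> (\<forall>i<5. R' i = R i))" for R M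
      by (rule wp_loop[where N = "R 6" and I = "\<lambda>m t (R', M'). R' 5 = R 5 + m * R 4 \<and> R' 6 = R 6 - m \<and> (\<forall>i<5. R' i = R i)", THEN wp_mono])
        (auto intro!: add[THEN wp_mono])
    have pow: "wp ?pow (R, M) (\<lambda>T (R', M'). R' 4 = R 4 * R 3 ^ R 2)" for R M
      by (rule wp_loop[where N = "R 2" and I = "\<lambda>m t (R', M'). R' 4 = R 4 * R 3 ^ m \<and> R' 3 = R 3 \<and> R' 2 = R 2 - m", THEN wp_mono])
        (auto intro!: mult[THEN wp_mono])
    show ?thesis
      unfolding power_com_def initial_state_def
      by simp (rule pow[THEN wp_mono], auto)
  qed
  then show ?thesis
    unfolding computable_def wp_def by blast
qed

theorem theorem4:
  "(\<exists>c C d. \<forall>(G, s, t, k, l)\<in>sup_instances.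
      decides_within c (encode_sup (G, s, t, k, l)) (short_unsecluded_path (G, s, t, k, l))
        (C * (l + 1) ^ k * card (verts G) ^ d)) \<and>
   fixed_parameter_tractable sup_instances encode_sup short_unsecluded_path
     (\<lambda>(G, s, t, k, l). k + l)"
proof
  have main: "decides_within decide (encode_sup (G, s, t, k, l)) (short_unsecluded_path (G, s, t, k, l))
      (1000 * (l + 1) ^ k * card (verts G) ^ 4)" if "(G, s, t, k, l) \<in> sup_instances" for G s t k l
  proof -
    interpret sup_search G s t k l by standard (rule that)
    show ?thesis using decides_decide unfolding n_def .
  qed
  then show "\<exists>c C d. \<forall>(G, s, t, k, l)\<in>sup_instances.
      decides_within c (encode_sup (G, s, t, k, l)) (short_unsecluded_path (G, s, t, k, l))
        (C * (l + 1) ^ k * card (verts G) ^ d)"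
    by blast
  have "decides_within decide (encode_sup (G, s, t, k, l)) (short_unsecluded_path (G, s, t, k, l))
      ((k + l + 1) ^ (k + l) * input_size (encode_sup (G, s, t, k, l)) ^ 14)"
    if inst: "(G, s, t, k, l) \<in> sup_instances" for G s t k l
  proof -
    interpret sup_search G s t k l by standard (rule inst)
    have "N \<le> input_size input"
      using length_le_input_size[of input] length_input by simp
    moreover have "n \<le> N"
      unfolding N_def by (cases n) auto
    ultimately have size: "2 \<le> input_size input" "n \<le> input_size input"
      unfolding N_def by auto
    \<comment> \<open>The bound defining tractability has no separate constant factor. The factor
      1000 is absorbed by the input size, which is at least 2; this makes the exponent 10 +
      4.\<close>
    have "(1000::nat) \<le> 2 ^ 10" by simp
    also have "\<dots> \<le> input_size input ^ 10" using size by (intro power_mono) auto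
    finally have const: "1000 \<le> input_size input ^ 10" .
    have "(l + 1) ^ k \<le> (k + l + 1) ^ k" by (intro power_mono) auto
    also have "\<dots> \<le> (k + l + 1) ^ (k + l)" by (intro power_increasing) auto
    finally have "1000 * (l + 1) ^ k * n ^ 4 \<le> input_size input ^ 10 * (k + l + 1) ^ (k + l) * input_size input ^ 4"
      using const size by (intro mult_mono power_mono) auto
    also have "\<dots> = (k + l + 1) ^ (k + l) * input_size input ^ 14"
      by (simp add: power_add[symmetric])
    finally show ?thesis
      using main[OF inst] unfolding n_def decides_within_def by (meson order_trans)
  qed
  then show "fixed_parameter_tractable sup_instances encode_sup short_unsecluded_path
      (\<lambda>(G, s, t, k, l). k + l)"
    unfolding fixed_parameter_tractable_def using computable_power
    by (intro exI[of _ decide] exI[of _ "\<lambda>p. (p + 1) ^ p"] exI[of _ 14]) auto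
qed

end
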